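(* Let $v_1, \ldots, v_k$ be directions in $\mathbb{R}^d$ and let $\mathcal{C}$ be the family of zonotopes with directions $v_1, \ldots, v_k$ in $\mathbb{R}^d$. Let $\mu$ be a $\min$-concave measure in $\mathbb{R}^d$. Then, for any finite family $\mathcal{F}$ of convex sets in $\mathbb{R}^d$, if the intersection of every $k+d$ or fewer sets in $\mathcal{F}$ contains a zonotope $K \in \mathcal{C}$ with $\mu(K) \ge 1$, then $\bigcap \mathcal{F}$ contains a zonotope $K \in \mathcal{C}$ with $\mu(K) \ge 1$.
   Context: Directions are nonzero vectors. A zonotope with directions $v_1, \ldots, v_k$ is a set $p + \big((\alpha_1 v_1) \oplus \cdots \oplus (\alpha_k v_k)\big)$ with $p \in \mathbb{R}^d$, $\alpha_i \ge 0$, where $\alpha_i v_i$ denotes the segment from $0$ to $\alpha_i v_i$ and $\oplus$ is the Minkowski sum. A measure $\mu$ on $\mathbb{R}^d$ is $\min$-concave if $\mu(\lambda A \oplus (1-\lambda) B) \ge \min\{\mu(A), \mu(B)\}$ for all (relevant) sets $A, B$ and $\lambda \in [0,1]$. *)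

theory Defs
  imports "HOL-Analysis.Analysis"
begin

text \<open>
  Sums of sets are Minkowski sums (theory Set_Algebras): the binary \<open>+\<close>, the iterated
  \<open>\<Sum>\<close> and the translation \<open>p +o A\<close>.
\<close>

definition zonotopes :: "nat \<Rightarrow> (nat \<Rightarrow> 'a::real_vector) \<Rightarrow> 'a set set" where
  "zonotopes k v =
     {p +o (\<Sum>i\<in>{1..k}. closed_segment 0 (\<alpha> i *\<^sub>R v i)) | p \<alpha>. \<forall>i\<in>{1..k}. 0 \<le> \<alpha> i}"

text \<open>
  The sets tested are the compact convex ones. Minkowski combinations of these are again compact,
  so no measurability side condition on the combination is needed, and the property
  is implied by the same inequality for all Borel sets (with Borel combination), all compact sets,
  or all measurable convex sets.
\<close>

definition min_concave :: "'a::euclidean_space measure \<Rightarrow> bool" where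
  "min_concave \<mu> \<longleftrightarrow>
     (\<forall>A B. \<forall>t\<in>{0..1::real}. compact A \<and> convex A \<and> compact B \<and> convex B \<longrightarrow>
        emeasure \<mu> ((*\<^sub>R) t ` A + (*\<^sub>R) (1 - t) ` B) \<ge> min (emeasure \<mu> A) (emeasure \<mu> B))"

end

theory Submission
  imports Defs
begin

text \<open>
  A zonotope with the given directions is described by its base point and its \<open>k\<close> lengths, so it is
  a point of a \<open>(k + d)\<close>-dimensional space, in which both \<open>being contained in F\<close> and \<open>having measure
  at least 1\<close> are convex conditions; Helly's theorem there would give \<open>k + d + 1\<close>. To save one,
  project away the first length. If a point lies in the projections of all the parameter sets, each
  \<open>F\<close> contains a zonotope of measure at least 1, and these differ only in their first length; the
  one whose first length is smallest lies in all the others, hence in every \<open>F\<close>. Helly's theorem in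
  dimension \<open>k + d - 1\<close> therefore suffices.
\<close>

section \<open>Helly's theorem in coordinate spaces of variable dimension\<close>

text \<open>
  The dimension depends on the term variable \<open>k\<close>, so it cannot be a type; points are functions of
  which only the coordinates in a finite set \<open>J\<close> matter.
\<close>

lemma nontrivial_linear_relation:
  fixes c :: "'i \<Rightarrow> 'j \<Rightarrow> 'a::field"
  assumes "finite J" "finite I" "card J < card I"
  shows "\<exists>u. (\<exists>i\<in>I. u i \<noteq> 0) \<and> (\<forall>j\<in>J. (\<Sum>i\<in>I. u i * c i j) = 0)"
  using assms
proof (induction J arbitrary: I c rule: finite_induct)
  case empty
  then have "\<exists>i. i \<in> I" by (metis card.empty all_not_in_conv less_irrefl)
  then show ?case by (intro exI[of _ "\<lambda>_. 1"]) auto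
next
  case (insert j J)
  show ?case
  proof (cases "\<forall>i\<in>I. c i j = 0")
    case True
    obtain u where "\<exists>i\<in>I. u i \<noteq> 0" "\<forall>j\<in>J. (\<Sum>i\<in>I. u i * c i j) = 0"
      using insert.IH[of I c] insert.prems insert.hyps by auto
    with True show ?thesis by (intro exI[of _ u]) auto
  next
    case False
    then obtain i0 where i0: "i0 \<in> I" "c i0 j \<noteq> 0" by blast
    \<comment> \<open>Gaussian elimination with pivot \<open>c i0 j\<close>: equation
      \<open>j\<close> serves to remove the unknown \<open>i0\<close> from the other
      equations.\<close>
    define I' where "I' = I - {i0}"
    have I': "finite I'" "i0 \<notin> I'" "I = Set.insert i0 I'" "card J < card I'"
      using insert.prems insert.hyps i0 by (auto simp: I'_def)
    obtain u where u: "\<exists>i\<in>I'. u i \<noteq> 0"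
      "\<forall>l\<in>J. (\<Sum>i\<in>I'. u i * (c i l - c i j / c i0 j * c i0 l)) = 0"
      using insert.IH[OF I'(1,4), of "\<lambda>i l. c i l - c i j / c i0 j * c i0 l"] by blast
    \<comment> \<open>The value at \<open>i0\<close> is the one that equation \<open>j\<close>
      forces, given the other unknowns.\<close>
    define w where "w = u(i0 := - (\<Sum>i\<in>I'. u i * c i j) / c i0 j)"
    have w: "(\<Sum>i\<in>I. w i * c i l) =
        (\<Sum>i\<in>I'. u i * c i l) - (\<Sum>i\<in>I'. u i * c i j) / c i0 j * c i0 l" for l
    proof -
      have "(\<Sum>i\<in>I'. w i * c i l) = (\<Sum>i\<in>I'. u i * c i l)"
        using I' by (intro sum.cong) (auto simp: w_def)
      then show ?thesis using I' by (simp add: w_def)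
    qed
    have "(\<Sum>i\<in>I. w i * c i l) = 0" if "l \<in> J" for l
    proof -
      have "(\<Sum>i\<in>I'. u i * (c i l - c i j / c i0 j * c i0 l)) = (\<Sum>i\<in>I. w i * c i l)"
        unfolding w
        by (simp add: algebra_simps sum_subtractf sum_distrib_left sum_divide_distrib)
      with u(2) that show ?thesis by simp
    qed
    moreover have "(\<Sum>i\<in>I. w i * c i j) = 0" using i0 by (simp add: w)
    moreover have "\<exists>i\<in>I. w i \<noteq> 0" using u(1) I' by (metis fun_upd_other insertI2 w_def)
    ultimately show ?thesis by (intro exI[of _ w]) auto
  qed
qed

section \<open>Convexity and Radon points\<close>

definition coord_convex :: "('j \<Rightarrow> real) set \<Rightarrow> bool" where
  "coord_convex S \<longleftrightarrow>
     (\<forall>x\<in>S. \<forall>y\<in>S. \<forall>t\<in>{0..1}. (\<lambda>j. t * x j + (1 - t) * y j) \<in> S)"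

lemma coord_convexD:
  "coord_convex S \<Longrightarrow> x \<in> S \<Longrightarrow> y \<in> S \<Longrightarrow> 0 \<le> t \<Longrightarrow> t \<le> 1 \<Longrightarrow>
    (\<lambda>j. t * x j + (1 - t) * y j) \<in> S"
  by (auto simp: coord_convex_def)

text \<open>Points are split off one at a time: the new mean is a convex combination of the new
  point and the old mean, with weight \<open>w a / (w a + V)\<close>. Positive weights keep the
  denominators nonzero.\<close>

lemma coord_convex_weighted_mean:
  assumes "coord_convex S" "finite P" "P \<noteq> {}"
    and "\<And>i. i \<in> P \<Longrightarrow> w i > 0" "\<And>i. i \<in> P \<Longrightarrow> x i \<in> S"
  shows "(\<lambda>j. (\<Sum>i\<in>P. w i * x i j) / sum w P) \<in> S"
  using assms(2-5)
proof (induction P rule: finite_ne_induct)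
  case (singleton a)
  then have "w a \<noteq> 0" by force
  then show ?case using singleton by simp
next
  case (insert a P)
  define V where "V = sum w P"
  have V: "V > 0" unfolding V_def using insert by (intro sum_pos) auto
  have a: "w a > 0" using insert by auto
  let ?t = "w a / (w a + V)"
  have t: "0 \<le> ?t" "?t \<le> 1" using a V by auto
  have "(\<lambda>j. ?t * x a j + (1 - ?t) * ((\<Sum>i\<in>P. w i * x i j) / V)) \<in> S"
    using insert t unfolding V_def[symmetric] by (intro coord_convexD[OF assms(1)]) auto
  also have "(\<lambda>j. ?t * x a j + (1 - ?t) * ((\<Sum>i\<in>P. w i * x i j) / V)) =
      (\<lambda>j. (\<Sum>i\<in>Set.insert a P. w i * x i j) / sum w (Set.insert a P))"
  proof
    fix j
    have "1 - ?t = V / (w a + V)" using a V by (simp add: field_simps)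
    then show "?t * x a j + (1 - ?t) * ((\<Sum>i\<in>P. w i * x i j) / V) =
        (\<Sum>i\<in>Set.insert a P. w i * x i j) / sum w (Set.insert a P)"
      using insert.hyps V by (simp add: V_def[symmetric] add_divide_distrib)
  qed
  finally show ?case .
qed

text \<open>Radon's argument, by induction on the size of \<open>F\<close>. The hypothesis
  \<open>cong\<close> makes each \<open>C f\<close> a cylinder over the coordinates in
  \<open>J\<close>, so \<open>card J\<close> acts as the dimension.\<close>

theorem coord_helly:
  fixes C :: "'f \<Rightarrow> ('j \<Rightarrow> real) set"
  assumes J: "finite J" and "finite F"
    and cvx: "\<And>f. f \<in> F \<Longrightarrow> coord_convex (C f)"
    and cong: "\<And>f x y. f \<in> F \<Longrightarrow> x \<in> C f \<Longrightarrow> (\<And>j. j \<in> J \<Longrightarrow> x j = y j) \<Longrightarrow> y \<in> C f"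
    and local: "\<And>G. G \<subseteq> F \<Longrightarrow> card G \<le> card J + 1 \<Longrightarrow> (\<Inter>f\<in>G. C f) \<noteq> {}"
  shows "(\<Inter>f\<in>F. C f) \<noteq> {}"
  using assms(2-5)
proof (induction "card F" arbitrary: F rule: less_induct)
  case less
  note cvx = less.prems(2) and cong = less.prems(3) and local = less.prems(4)
  show ?case
  proof (cases "card F \<le> card J + 1")
    case True
    then show ?thesis using local[of F] by simp
  next
    case False
    have others: "(\<Inter>g\<in>F - {f}. C g) \<noteq> {}" if "f \<in> F" for f
    proof (rule less.hyps)
      show "card (F - {f}) < card F" using that less.prems(1) by (intro card_Diff1_less)
    next
      fix G assume "G \<subseteq> F - {f}" "card G \<le> card J + 1"
      then show "(\<Inter>g\<in>G. C g) \<noteq> {}" by (intro local) auto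
    next
      fix g y z assume "g \<in> F - {f}" "y \<in> C g" "\<And>j. j \<in> J \<Longrightarrow> y j = z j"
      then show "z \<in> C g" using cong[of g y z] by blast
    qed (use less.prems(1) cvx in simp_all)
    \<comment> \<open>A point common to all the sets other than \<open>C f\<close>, which it may
      miss.\<close>
    define x where "x f = (SOME y. y \<in> (\<Inter>g\<in>F - {f}. C g))" for f
    have x: "x f \<in> C g" if "f \<in> F" "g \<in> F" "f \<noteq> g" for f g
    proof -
      have "x f \<in> (\<Inter>g\<in>F - {f}. C g)"
        unfolding x_def using others[OF that(1)] by (rule some_in_eq[THEN iffD2])
      then show ?thesis using that by blast
    qed
    \<comment> \<open>The extra coordinate \<open>None\<close> is constantly 1, so a linear relation
      over \<open>L\<close> is an affine dependence of the points: its coefficients sum to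
      0.\<close>
    define c where "c f l = (case l of None \<Rightarrow> 1 | Some j \<Rightarrow> x f j)" for f l
    define L where "L = Set.insert None (Some ` J)"
    have "card L = card J + 1"
      using J by (subst L_def, subst card_insert_disjoint) (auto simp: card_image)
    then obtain u where u: "\<exists>f\<in>F. u f \<noteq> 0" "\<And>l. l \<in> L \<Longrightarrow> (\<Sum>f\<in>F. u f * c f l) = 0"
      using nontrivial_linear_relation[of L F c] J False less.prems(1) by (auto simp: L_def)
    have u0: "(\<Sum>f\<in>F. u f) = 0" using u(2)[of None] by (simp add: c_def L_def)
    have uJ: "(\<Sum>f\<in>F. u f * x f j) = 0" if "j \<in> J" for j
      using u(2)[of "Some j"] that by (simp add: c_def L_def)
    define P where "P = {f \<in> F. u f > 0}"
    define N where "N = {f \<in> F. u f < 0}"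
    have fin: "finite P" "finite N" using less.prems(1) by (auto simp: P_def N_def)
    have split: "(\<Sum>f\<in>F. u f * h f) = (\<Sum>f\<in>P. u f * h f) - (\<Sum>f\<in>N. - u f * h f)" for h
    proof -
      have "(\<Sum>f\<in>F. u f * h f) = (\<Sum>f\<in>P \<union> N. u f * h f)"
        using less.prems(1) by (intro sum.mono_neutral_right) (auto simp: P_def N_def)
      also have "\<dots> = (\<Sum>f\<in>P. u f * h f) + (\<Sum>f\<in>N. u f * h f)"
        using fin by (intro sum.union_disjoint) (auto simp: P_def N_def)
      finally show ?thesis by (simp add: sum_negf)
    qed
    have s: "sum u P = (\<Sum>f\<in>N. - u f)" using split[of "\<lambda>_. 1"] u0 by simp
    have sj: "(\<Sum>f\<in>P. u f * x f j) = (\<Sum>f\<in>N. - u f * x f j)" if "j \<in> J" for j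
      using split[of "\<lambda>f. x f j"] uJ[OF that] by simp
    \<comment> \<open>Both parts carry the same total weight \<open>s\<close>, so neither can be
      empty alone.\<close>
    have "P \<noteq> {} \<or> N \<noteq> {}" using u(1) by (force simp: P_def N_def)
    moreover have "P \<noteq> {} \<Longrightarrow> sum u P > 0" using fin by (intro sum_pos) (auto simp: P_def)
    moreover have "N \<noteq> {} \<Longrightarrow> (\<Sum>f\<in>N. - u f) > 0"
      using fin by (intro sum_pos) (auto simp: N_def)
    ultimately have ne: "P \<noteq> {}" "N \<noteq> {}" using s by force+
    \<comment> \<open>Two forms of the Radon point. They agree on \<open>J\<close> by
      \<open>s\<close> and \<open>sj\<close>, but perhaps not elsewhere, hence the appeal to
      \<open>cong\<close> below.\<close>
    let ?z = "\<lambda>j. (\<Sum>f\<in>P. u f * x f j) / sum u P"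
    let ?z' = "\<lambda>j. (\<Sum>f\<in>N. - u f * x f j) / (\<Sum>f\<in>N. - u f)"
    \<comment> \<open>Only \<open>x g\<close> may miss \<open>C g\<close>, so the mean is taken over
      the part that avoids \<open>g\<close>: \<open>N\<close> if \<open>g\<close> is in
      \<open>P\<close>, and \<open>P\<close> otherwise.\<close>
    have "?z \<in> C g" if g: "g \<in> F" for g
    proof (cases "g \<in> P")
      case True
      have "?z' \<in> C g"
        using cvx[OF g] fin(2) ne(2)
      proof (rule coord_convex_weighted_mean)
        fix i assume "i \<in> N"
        then show "- u i > 0" "x i \<in> C g" using True g by (auto simp: N_def P_def intro: x)
      qed
      then show ?thesis by (rule cong[OF g]) (simp only: s sj)
    next
      case False
      show ?thesis
        using cvx[OF g] fin(1) ne(1)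
      proof (rule coord_convex_weighted_mean)
        fix i assume "i \<in> P"
        then show "u i > 0" "x i \<in> C g" using False g by (auto simp: P_def intro: x)
      qed
    qed
    then show ?thesis by blast
  qed
qed

section \<open>Zonotopes as points of a parameter space\<close>

definition zonotope :: "nat \<Rightarrow> (nat \<Rightarrow> 'a::real_vector) \<Rightarrow> 'a \<Rightarrow> (nat \<Rightarrow> real) \<Rightarrow> 'a set" where
  "zonotope k v p \<alpha> = p +o (\<Sum>i\<in>{1..k}. closed_segment 0 (\<alpha> i *\<^sub>R v i))"

lemma zonotopes_eq: "zonotopes k v = {zonotope k v p \<alpha> | p \<alpha>. \<forall>i\<in>{1..k}. 0 \<le> \<alpha> i}"
  by (simp add: zonotopes_def zonotope_def)

section \<open>Compactness, convexity and Minkowski arithmetic of zonotopes\<close>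

lemma elt_set_plus_eq_image: "p +o A = (+) p ` A"
  by (auto simp: elt_set_plus_def)

lemma compact_set_plus:
  fixes A B :: "'a::real_normed_vector set"
  assumes "compact A" "compact B"
  shows "compact (A + B)"
proof -
  have "A + B = {x + y | x y. x \<in> A \<and> y \<in> B}" by (auto simp: set_plus_def)
  then show ?thesis using compact_sums[OF assms] by simp
qed

text \<open>Together with \<open>convex_zonotope\<close>, this makes \<open>min_concave\<close>
  applicable to zonotopes.\<close>

lemma compact_zonotope:
  fixes v :: "nat \<Rightarrow> 'a::real_normed_vector"
  shows "compact (zonotope k v p \<alpha>)"
proof -
  have "compact (\<Sum>i\<in>I. closed_segment 0 (\<alpha> i *\<^sub>R v i))" if "finite I" for I
    using that by induction (auto intro: compact_set_plus)
  then show ?thesis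
    unfolding zonotope_def elt_set_plus_eq_image by (intro compact_translation) auto
qed

lemma convex_zonotope: "convex (zonotope k v p \<alpha>)"
  unfolding zonotope_def elt_set_plus_eq_image
  by (intro convex_translation convex_set_sum convex_closed_segment)

lemma closed_segment_0_scaleR:
  fixes v :: "'a::real_vector"
  assumes "0 \<le> a"
  shows "closed_segment 0 (a *\<^sub>R v) = (\<lambda>s. s *\<^sub>R v) ` {0..a}"
proof -
  have "closed_segment 0 (a *\<^sub>R v) = (\<lambda>s. s *\<^sub>R v) ` closed_segment 0 a"
    using closed_segment_linear_image[of "\<lambda>s. s *\<^sub>R v" 0 a] by (simp add: linear_iff algebra_simps)
  with assms show ?thesis by (simp add: closed_segment_eq_real_ivl)
qed

text \<open>Along one direction this is the addition of the intervals from 0 to \<open>a\<close> and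
  from 0 to \<open>b\<close>; lengths of opposite sign would not simply add.\<close>

lemma closed_segment_0_add:
  fixes v :: "'a::real_vector"
  assumes "0 \<le> a" "0 \<le> b"
  shows "closed_segment 0 (a *\<^sub>R v) + closed_segment 0 (b *\<^sub>R v) = closed_segment 0 ((a + b) *\<^sub>R v)"
proof (intro equalityI subsetI)
  fix x assume "x \<in> closed_segment 0 (a *\<^sub>R v) + closed_segment 0 (b *\<^sub>R v)"
  then obtain s t where "s \<in> {0..a}" "t \<in> {0..b}" "x = s *\<^sub>R v + t *\<^sub>R v"
    using assms by (auto simp: closed_segment_0_scaleR elim!: set_plus_elim)
  then have "x = (s + t) *\<^sub>R v" "s + t \<in> {0..a + b}" by (auto simp: algebra_simps)
  then show "x \<in> closed_segment 0 ((a + b) *\<^sub>R v)"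
    using assms by (auto simp: closed_segment_0_scaleR)
next
  fix x assume "x \<in> closed_segment 0 ((a + b) *\<^sub>R v)"
  then obtain r where r: "r \<in> {0..a + b}" "x = r *\<^sub>R v"
    using assms by (auto simp: closed_segment_0_scaleR)
  \<comment> \<open>Greedy split: the first part takes as much of \<open>r\<close> as
    \<open>a\<close> allows, and the rest is at most \<open>b\<close>.\<close>
  have "x = min r a *\<^sub>R v + (r - min r a) *\<^sub>R v" by (simp add: r algebra_simps)
  moreover have "min r a *\<^sub>R v \<in> closed_segment 0 (a *\<^sub>R v)"
    "(r - min r a) *\<^sub>R v \<in> closed_segment 0 (b *\<^sub>R v)"
    using assms r by (auto simp: closed_segment_0_scaleR intro!: imageI)
  ultimately show "x \<in> closed_segment 0 (a *\<^sub>R v) + closed_segment 0 (b *\<^sub>R v)"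
    by (metis set_plus_intro)
qed

lemma scaleR_image_set_plus:
  fixes A B :: "'a::real_vector set"
  shows "(*\<^sub>R) t ` (A + B) = (*\<^sub>R) t ` A + (*\<^sub>R) t ` B"
  unfolding set_plus_image image_image image_paired_Times[symmetric]
  by (simp add: image_image case_prod_unfold scaleR_add_right)

lemma scaleR_image_zonotope:
  fixes v :: "nat \<Rightarrow> 'a::real_vector"
  shows "(*\<^sub>R) t ` zonotope k v p \<alpha> = zonotope k v (t *\<^sub>R p) (\<lambda>i. t * \<alpha> i)"
proof -
  have seg: "(*\<^sub>R) t ` closed_segment 0 x = closed_segment 0 (t *\<^sub>R x)" for x :: 'a
    using closed_segment_linear_image[of "(*\<^sub>R) t" 0 x] by simp
  have "(*\<^sub>R) t ` (\<Sum>i\<in>{1..k}. closed_segment 0 (\<alpha> i *\<^sub>R v i)) =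
      (\<Sum>i\<in>{1..k}. (*\<^sub>R) t ` closed_segment 0 (\<alpha> i *\<^sub>R v i))"
    by (subst sum_set_linear) (auto simp: scaleR_image_set_plus)
  then have "(*\<^sub>R) t ` (\<Sum>i\<in>{1..k}. closed_segment 0 (\<alpha> i *\<^sub>R v i)) =
      (\<Sum>i\<in>{1..k}. closed_segment 0 ((t * \<alpha> i) *\<^sub>R v i))"
    by (simp add: seg)
  then have "zonotope k v (t *\<^sub>R p) (\<lambda>i. t * \<alpha> i) =
      (t *\<^sub>R p) +o ((*\<^sub>R) t ` (\<Sum>i\<in>{1..k}. closed_segment 0 (\<alpha> i *\<^sub>R v i)))"
    by (simp add: zonotope_def)
  then show ?thesis
    by (simp add: zonotope_def elt_set_plus_eq_image image_image scaleR_add_right)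
qed

lemma zonotope_plus:
  assumes "\<And>i. i \<in> {1..k} \<Longrightarrow> 0 \<le> \<alpha> i" "\<And>i. i \<in> {1..k} \<Longrightarrow> 0 \<le> \<beta> i"
  shows "zonotope k v p \<alpha> + zonotope k v q \<beta> = zonotope k v (p + q) (\<lambda>i. \<alpha> i + \<beta> i)"
  unfolding zonotope_def set_plus_rearrange sum.distrib[symmetric]
  using assms by (intro arg_cong[where f = "(+o) _"] sum.cong closed_segment_0_add) auto

text \<open>The parametrisation respects convex combinations, so min-concavity can be read as a
  condition on parameters.\<close>

lemma zonotope_convex_combination:
  assumes "\<And>i. i \<in> {1..k} \<Longrightarrow> 0 \<le> \<alpha> i" "\<And>i. i \<in> {1..k} \<Longrightarrow> 0 \<le> \<beta> i" "0 \<le> t" "t \<le> 1"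
  shows "(*\<^sub>R) t ` zonotope k v p \<alpha> + (*\<^sub>R) (1 - t) ` zonotope k v q \<beta> =
    zonotope k v (t *\<^sub>R p + (1 - t) *\<^sub>R q) (\<lambda>i. t * \<alpha> i + (1 - t) * \<beta> i)"
  unfolding scaleR_image_zonotope using assms by (intro zonotope_plus) auto

lemma zonotope_mono:
  assumes "\<And>i. i \<in> {1..k} \<Longrightarrow> 0 \<le> \<alpha> i" "\<And>i. i \<in> {1..k} \<Longrightarrow> \<alpha> i \<le> \<beta> i"
  shows "zonotope k v p \<alpha> \<subseteq> zonotope k v p \<beta>"
proof -
  have "closed_segment 0 (\<alpha> i *\<^sub>R v i) \<subseteq> closed_segment 0 (\<beta> i *\<^sub>R v i)" if "i \<in> {1..k}" for i
    using assms[OF that] by (auto simp: closed_segment_0_scaleR)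
  then have "(\<Sum>i\<in>{1..k}. closed_segment 0 (\<alpha> i *\<^sub>R v i)) \<subseteq>
      (\<Sum>i\<in>{1..k}. closed_segment 0 (\<beta> i *\<^sub>R v i))"
    unfolding set_sum_alt[OF finite_atLeastAtMost] by blast
  then show ?thesis unfolding zonotope_def by (rule set_plus_mono)
qed

section \<open>The parameter set belonging to one set \<open>F\<close>\<close>

definition large_in :: "nat \<Rightarrow> (nat \<Rightarrow> 'a::euclidean_space) \<Rightarrow> 'a measure \<Rightarrow> 'a set \<Rightarrow>
    'a \<Rightarrow> (nat \<Rightarrow> real) \<Rightarrow> bool" where
  "large_in k v \<mu> F p \<alpha> \<longleftrightarrow>
     (\<forall>i\<in>{1..k}. 0 \<le> \<alpha> i) \<and> zonotope k v p \<alpha> \<subseteq> F \<and> emeasure \<mu> (zonotope k v p \<alpha>) \<ge> 1"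

lemma large_in_cong:
  "(\<And>i. i \<in> {1..k} \<Longrightarrow> \<alpha> i = \<beta> i) \<Longrightarrow> large_in k v \<mu> F p \<alpha> = large_in k v \<mu> F p \<beta>"
  by (simp add: large_in_def zonotope_def)

text \<open>Containment survives by convexity of \<open>F\<close>, and the measure bound because
  min-concavity makes the superlevel set of parameters convex.\<close>

lemma large_in_convex_combination:
  assumes "min_concave \<mu>" "convex F"
    and A: "large_in k v \<mu> F p \<alpha>" and B: "large_in k v \<mu> F q \<beta>" and t: "0 \<le> t" "t \<le> 1"
  shows "large_in k v \<mu> F (t *\<^sub>R p + (1 - t) *\<^sub>R q) (\<lambda>i. t * \<alpha> i + (1 - t) * \<beta> i)"
proof -
  let ?A = "zonotope k v p \<alpha>" and ?B = "zonotope k v q \<beta>"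
  have eq: "zonotope k v (t *\<^sub>R p + (1 - t) *\<^sub>R q) (\<lambda>i. t * \<alpha> i + (1 - t) * \<beta> i) =
      (*\<^sub>R) t ` ?A + (*\<^sub>R) (1 - t) ` ?B"
    using A B t by (intro zonotope_convex_combination[symmetric]) (auto simp: large_in_def)
  have "min (emeasure \<mu> ?A) (emeasure \<mu> ?B) \<le>
      emeasure \<mu> ((*\<^sub>R) t ` ?A + (*\<^sub>R) (1 - t) ` ?B)"
    using assms(1) t unfolding min_concave_def by (auto simp: compact_zonotope convex_zonotope)
  moreover have "1 \<le> min (emeasure \<mu> ?A) (emeasure \<mu> ?B)"
    using A B by (simp add: large_in_def)
  moreover have "(*\<^sub>R) t ` ?A + (*\<^sub>R) (1 - t) ` ?B \<subseteq> F"
  proof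
    fix x assume "x \<in> (*\<^sub>R) t ` ?A + (*\<^sub>R) (1 - t) ` ?B"
    then obtain a b where "a \<in> ?A" "b \<in> ?B" "x = t *\<^sub>R a + (1 - t) *\<^sub>R b"
      by (auto elim!: set_plus_elim)
    then show "x \<in> F"
      using A B t convexD[OF assms(2), of a b t "1 - t"] by (auto simp: large_in_def)
  qed
  moreover have "\<forall>i\<in>{1..k}. 0 \<le> t * \<alpha> i + (1 - t) * \<beta> i"
    using A B t by (auto simp: large_in_def)
  ultimately show ?thesis unfolding large_in_def eq by (metis order_trans)
qed

lemma large_in_common_first_length:
  fixes v :: "nat \<Rightarrow> 'a::euclidean_space"
  assumes "finite \<F>" "\<And>F. F \<in> \<F> \<Longrightarrow> \<exists>a. large_in k v \<mu> F p (\<alpha>(1 := a))"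
    and "\<F> \<noteq> {}"
  shows "\<exists>a. \<forall>F\<in>\<F>. large_in k v \<mu> F p (\<alpha>(1 := a))"
proof -
  obtain a where a: "\<And>F. F \<in> \<F> \<Longrightarrow> large_in k v \<mu> F p (\<alpha>(1 := a F))"
    using assms(2) by metis
  \<comment> \<open>\<open>M\<close> has the least first length. Its zonotope lies in those of all
    other members by monotonicity, and the measure bound is its own.\<close>
  obtain M where M: "M \<in> \<F>" "\<And>F. F \<in> \<F> \<Longrightarrow> a M \<le> a F"
    using ex_min_if_finite[of "a ` \<F>"] assms(1,3) by (force simp: not_less)
  have "large_in k v \<mu> F p (\<alpha>(1 := a M))" if F: "F \<in> \<F>" for F
  proof -
    have "zonotope k v p (\<alpha>(1 := a M)) \<subseteq> zonotope k v p (\<alpha>(1 := a F))"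
      using a[OF M(1)] M(2)[OF F] by (intro zonotope_mono) (auto simp: large_in_def)
    then show ?thesis using a[OF M(1)] a[OF F] unfolding large_in_def by blast
  qed
  then show ?thesis by blast
qed

section \<open>Helly's theorem after projecting away the first length\<close>

theorem theorem2p6:
  fixes k :: nat
    and v :: "nat \<Rightarrow> real ^ 'd"
    and \<mu> :: "(real ^ 'd) measure"
    and \<F> :: "(real ^ 'd) set set"
  assumes k: "k \<ge> 1"
    and directions: "\<And>i. i \<in> {1..k} \<Longrightarrow> v i \<noteq> 0"
    and borel: "sets borel \<subseteq> sets \<mu>"
    and concave: "min_concave \<mu>"
    and finite: "finite \<F>"
    and convex: "\<And>F. F \<in> \<F> \<Longrightarrow> convex F"
    and local: "\<And>\<G>. \<G> \<subseteq> \<F> \<Longrightarrow> card \<G> \<le> k + CARD('d) \<Longrightarrow>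
                  \<exists>K\<in>zonotopes k v. K \<subseteq> \<Inter>\<G> \<and> emeasure \<mu> K \<ge> 1"
  shows "\<exists>K\<in>zonotopes k v. K \<subseteq> \<Inter>\<F> \<and> emeasure \<mu> K \<ge> 1"
proof (cases "\<F> = {}")
  case True
  then show ?thesis using local[of "{}"] by simp
next
  case False
  \<comment> \<open>The \<open>Inl\<close> coordinates hold the base point, the \<open>Inr\<close>
    coordinates the lengths.\<close>
  define base :: "('d + nat \<Rightarrow> real) \<Rightarrow> real ^ 'd" where "base x = (\<chi> i. x (Inl i))" for x
  \<comment> \<open>The projection, written as a cylinder: entry 1 is overwritten by a quantified
    \<open>a\<close>, so \<open>x (Inr 1)\<close> is ignored.\<close>
  define C where "C F = {x. \<exists>a. large_in k v \<mu> F (base x) ((\<lambda>i. x (Inr i))(1 := a))}" for F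
  \<comment> \<open>Lengths start at index 2, so the bound \<open>card J + 1\<close> in Helly's
    theorem is exactly \<open>k + CARD('d)\<close>; this uses \<open>k \<ge> 1\<close>.\<close>
  define J :: "('d + nat) set" where "J = UNIV <+> {2..k}"
  have J: "finite J" "card J + 1 = k + CARD('d)"
    using k by (auto simp: J_def card_Plus)
  have "(\<Inter>F\<in>\<F>. C F) \<noteq> {}"
  proof (rule coord_helly[OF J(1) finite])
    fix F assume F: "F \<in> \<F>"
    show "coord_convex (C F)"
      unfolding coord_convex_def
    proof (intro ballI)
      fix x y and t :: real assume "x \<in> C F" "y \<in> C F" and t: "t \<in> {0..1}"
      then obtain a b where "large_in k v \<mu> F (base x) ((\<lambda>i. x (Inr i))(1 := a))"
        "large_in k v \<mu> F (base y) ((\<lambda>i. y (Inr i))(1 := b))"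
        by (auto simp: C_def)
      \<comment> \<open>A projection of a convex set is convex: \<open>t * a + (1 - t) * b\<close>
        is the first length for the combined point.\<close>
      from large_in_convex_combination[OF concave convex[OF F] this, of t] t
      have "large_in k v \<mu> F (t *\<^sub>R base x + (1 - t) *\<^sub>R base y)
        (\<lambda>i. t * ((\<lambda>i. x (Inr i))(1 := a)) i + (1 - t) * ((\<lambda>i. y (Inr i))(1 := b)) i)"
        by simp
      also have "t *\<^sub>R base x + (1 - t) *\<^sub>R base y = base (\<lambda>j. t * x j + (1 - t) * y j)"
        by (simp add: base_def vec_eq_iff)
      also have "(\<lambda>i. t * ((\<lambda>i. x (Inr i))(1 := a)) i + (1 - t) * ((\<lambda>i. y (Inr i))(1 := b)) i) =
          (\<lambda>i. t * x (Inr i) + (1 - t) * y (Inr i))(1 := t * a + (1 - t) * b)"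
        by auto
      finally show "(\<lambda>j. t * x j + (1 - t) * y j) \<in> C F" unfolding C_def by blast
    qed
  next
    fix F x y assume F: "F \<in> \<F>" and x: "x \<in> C F" and xy: "\<And>j. j \<in> J \<Longrightarrow> x j = y j"
    obtain a where a: "large_in k v \<mu> F (base x) ((\<lambda>i. x (Inr i))(1 := a))"
      using x by (auto simp: C_def)
    have base: "base x = base y" using xy by (auto simp: base_def J_def vec_eq_iff)
    have "large_in k v \<mu> F (base y) ((\<lambda>i. x (Inr i))(1 := a)) =
        large_in k v \<mu> F (base y) ((\<lambda>i. y (Inr i))(1 := a))"
    \<comment> \<open>Index 1 is overwritten on both sides; the other relevant indices lie in
      \<open>J\<close>.\<close>
    proof (rule large_in_cong)
      fix i assume "i \<in> {1..k}"
      then show "((\<lambda>i. x (Inr i))(1 := a)) i = ((\<lambda>i. y (Inr i))(1 := a)) i"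
        by (cases "i = 1") (auto simp: J_def intro!: xy)
    qed
    then have "large_in k v \<mu> F (base y) ((\<lambda>i. y (Inr i))(1 := a))"
      using a unfolding base by blast
    then show "y \<in> C F" unfolding C_def by blast
  next
    fix \<G> assume "\<G> \<subseteq> \<F>" "card \<G> \<le> card J + 1"
    then obtain K where K: "K \<in> zonotopes k v" "K \<subseteq> \<Inter>\<G>" "emeasure \<mu> K \<ge> 1"
      using local J(2) by metis
    then obtain p \<alpha> where p: "K = zonotope k v p \<alpha>" "\<forall>i\<in>{1..k}. 0 \<le> \<alpha> i"
      by (auto simp: zonotopes_eq)
    \<comment> \<open>The parameters of \<open>K\<close> form a common point of the
      \<open>C F\<close>, with \<open>\<alpha> 1\<close> as witness for each.\<close>
    define x where "x = case_sum (($) p) \<alpha>"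
    have "large_in k v \<mu> F (base x) ((\<lambda>i. x (Inr i))(1 := \<alpha> 1))" if "F \<in> \<G>" for F
      using K p that by (auto simp: large_in_def x_def base_def fun_upd_idem)
    then have "x \<in> (\<Inter>F\<in>\<G>. C F)" unfolding C_def by blast
    then show "(\<Inter>F\<in>\<G>. C F) \<noteq> {}" by blast
  qed
  then obtain x where "\<And>F. F \<in> \<F> \<Longrightarrow> x \<in> C F" by blast
  \<comment> \<open>Over \<open>x\<close> each \<open>F\<close> has its own first length; the least
    one serves all.\<close>
  then obtain a where "\<forall>F\<in>\<F>. large_in k v \<mu> F (base x) ((\<lambda>i. x (Inr i))(1 := a))"
    using large_in_common_first_length[OF finite _ False, of k v \<mu> "base x" "\<lambda>i. x (Inr i)"]
    by (auto simp: C_def)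
  then have "zonotope k v (base x) ((\<lambda>i. x (Inr i))(1 := a)) \<in> zonotopes k v"
    "zonotope k v (base x) ((\<lambda>i. x (Inr i))(1 := a)) \<subseteq> \<Inter>\<F>"
    "emeasure \<mu> (zonotope k v (base x) ((\<lambda>i. x (Inr i))(1 := a))) \<ge> 1"
    using False unfolding large_in_def zonotopes_eq by blast+
  then show ?thesis by blast
qed

end
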